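(* Let $N\subset(0,\infty)$. Then there exists some nonempty compact set $A\subset\mathbb{R}$ such that $N_A=N$ if and only if $\sum_{s\in N}s<\infty$.
   Context: For nonempty compact $A\subset\mathbb{R}^d$ (here $d=1$) and $r>0$, let $A_r:=\{x\in\mathbb{R}^d: d(x,A)<r\}$, where $d(x,A)=\min_{y\in A}|x-y|$, and $V_A(r):=\lambda_d(A_r)$, where $\lambda_d$ is Lebesgue measure on $\mathbb{R}^d$. $N_A\subset(0,\infty)$ denotes the set of all $s>0$ at which the function $V_A:(0,\infty)\to\mathbb{R}$ is not differentiable. The sum $\sum_{s\in N}s$ is the (possibly infinite) sum of the positive numbers in the possibly infinite set $N$, i.e. the supremum of its finite partial sums. *)

theory Defs
  imports "HOL-Analysis.Analysis"
begin

text \<open>For nonempty compact \<open>A\<close> the infimum in \<^const>\<open>infdist\<close> is attained, so it is the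
  minimal distance (for empty \<open>A\<close> the library sets it to 0).\<close>

definition parallel_set :: "'a::euclidean_space set \<Rightarrow> real \<Rightarrow> 'a set" where
  "parallel_set A r = {x. infdist x A < r}"

definition parallel_volume :: "'a::euclidean_space set \<Rightarrow> real \<Rightarrow> real" where
  "parallel_volume A r = measure lebesgue (parallel_set A r)"

text \<open>The domain of the volume function is meant to be \<open>{0<..}\<close>. This set is open, so
  differentiability there at \<open>s > 0\<close> is two-sided differentiability of the total function.\<close>

definition nondiff_radii :: "'a::euclidean_space set \<Rightarrow> real set" where
  "nondiff_radii A = {s. s > 0 \<and> \<not> (parallel_volume A differentiable (at s))}"

text \<open>Sums of possibly infinite sets of positive reals are taken in \<^typ>\<open>ennreal\<close>, where the
  library's infinite sum always exists and is the supremum of the finite partial sums.\<close>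

lemma infsum_ennreal_eq_SUP:
  fixes N :: "real set"
  shows "(\<Sum>\<^sub>\<infinity>s\<in>N. ennreal s) = (SUP F\<in>{F. finite F \<and> F \<subseteq> N}. \<Sum>s\<in>F. ennreal s)"
  by (rule nonneg_infsum_complete) simp

end

theory Submission
  imports Defs
begin

text \<open>
  The non-differentiability radii of a nonempty compact set \<open>A\<close> of reals are exactly the
  half-lengths of its gaps, i.e. of the bounded components \<open>{c<..<d}\<close> of its complement. Indeed, if \<open>a\<close> and \<open>b\<close>
  are the least and the greatest element of \<open>A\<close>, then a point of \<open>{a - r<..<b + r}\<close> has distance
  at least \<open>r > 0\<close> from \<open>A\<close> iff it lies in \<open>{c + r..d - r}\<close> for some gap \<open>(c, d)\<close>. Hence the
  volume of the parallel set is \<open>b - a + 2 * r\<close> minus the sum of \<open>max (d - c - 2 * r) 0\<close> over all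
  gaps \<open>(c, d)\<close>. Gaps are disjoint subintervals of \<open>{a..b}\<close>, hence their
  lengths add up to at most \<open>b - a\<close>. In particular only finitely many terms of the sum are nonzero for \<open>r\<close> near a given \<open>s > 0\<close>, and
  each contributes a concave kink at \<open>(d - c) / 2\<close> only; kinks at the same place do not cancel.
  This is lemma \<open>nondiff_radii_eq_half_gap_lengths\<close>.

  The bound on the total length of the gaps gives one direction of the theorem. For the other, if
  \<open>N\<close> has a finite sum, intervals of the lengths \<open>2 * s\<close>, \<open>s \<in> N\<close>, are laid side by side in the
  order of increasing \<open>s\<close> and removed from \<open>{0..L}\<close>, where \<open>L\<close> is their total length. The compact
  set that remains has exactly these intervals as its gaps.
\<close>

section \<open>Gaps of a compact set of reals\<close>

text \<open>For closed \<open>A\<close>, the bounded components of its complement, encoded as pairs of endpoints.\<close>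

definition gaps :: "real set \<Rightarrow> (real \<times> real) set" where
  "gaps A = {(c, d). c < d \<and> c \<in> A \<and> d \<in> A \<and> {c<..<d} \<inter> A = {}}"

lemma gapsD:
  assumes "(c, d) \<in> gaps A"
  shows "c < d" "c \<in> A" "d \<in> A" "\<And>x. x \<in> A \<Longrightarrow> x \<le> c \<or> d \<le> x"
  using assms unfolding gaps_def by (auto simp: disjoint_iff) (metis not_less)

lemma gaps_overlap_eq:
  assumes "(c, d) \<in> gaps A" "(c', d') \<in> gaps A" "c < x" "x < d" "c' < x" "x < d'"
  shows "(c, d) = (c', d')"
  using gapsD[OF assms(1)] gapsD[OF assms(2)] assms(3-6) by (smt (verit))

lemma exists_gap:
  fixes A :: "real set"
  assumes "compact A" "x \<notin> A" "p \<in> A" "q \<in> A" "p < x" "x < q"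
  obtains c d where "(c, d) \<in> gaps A" "c < x" "x < d"
proof -
  have "compact (A \<inter> {..x})" "compact (A \<inter> {x..})"
    using assms(1) by (auto intro: compact_Int_closed)
  moreover have "A \<inter> {..x} \<noteq> {}" "A \<inter> {x..} \<noteq> {}"
    using assms by auto
  ultimately obtain c d where
    c: "c \<in> A \<inter> {..x}" "\<And>y. y \<in> A \<inter> {..x} \<Longrightarrow> y \<le> c" and
    d: "d \<in> A \<inter> {x..}" "\<And>y. y \<in> A \<inter> {x..} \<Longrightarrow> d \<le> y"
    using compact_attains_sup compact_attains_inf by metis
  have "c < x" "x < d"
    using c d assms(2) by (auto simp: less_le)
  moreover have "{c<..<d} \<inter> A = {}"
    using c(2) d(2) by (force simp: disjoint_iff)
  ultimately have "(c, d) \<in> gaps A"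
    using c(1) d(1) unfolding gaps_def by auto
  then show thesis
    using that \<open>c < x\<close> \<open>x < d\<close> by blast
qed

lemma sum_gap_lengths_le:
  assumes "finite F" "F \<subseteq> gaps A" "A \<subseteq> {a..b}" "a \<le> b"
  shows "(\<Sum>(c, d)\<in>F. d - c) \<le> b - a"
proof -
  let ?I = "\<lambda>(c, d). {c<..<d::real}"
  have "measure lebesgue (?I (c, d)) = d - c" if "(c, d) \<in> F" for c d
    using gapsD(1)[of c d A] assms(2) that by auto
  then have "(\<Sum>(c, d)\<in>F. d - c) = (\<Sum>g\<in>F. measure lebesgue (?I g))"
    by (intro sum.cong) auto
  also have "\<dots> = measure lebesgue (\<Union>g\<in>F. ?I g)"
  proof (rule measure_UNION'[symmetric])
    show "pairwise (\<lambda>g h. disjnt (?I g) (?I h)) F"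
    proof -
      have "g = h" if "g \<in> F" "h \<in> F" "x \<in> ?I g" "x \<in> ?I h" for g h x
        using that gaps_overlap_eq[of "fst g" "snd g" A "fst h" "snd h" x]
          subsetD[OF assms(2), of g] subsetD[OF assms(2), of h] by auto
      then show ?thesis
        unfolding pairwise_def disjnt_iff by blast
    qed
  qed (use assms(1) in auto)
  also have "\<dots> \<le> measure lebesgue {a..b}"
  proof (rule measure_mono_fmeasurable)
    show "(\<Union>g\<in>F. ?I g) \<subseteq> {a..b}"
      using assms(2,3) by (fastforce dest: gapsD)
    show "(\<Union>g\<in>F. ?I g) \<in> sets lebesgue"
      using assms(1) by (intro sets.finite_UN) auto
  qed auto
  finally show ?thesis
    using assms(4) by simp
qed

lemma finite_long_gaps:
  assumes "A \<subseteq> {a..b}" "a \<le> b" "\<delta> > 0"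
  shows "finite {(c, d) \<in> gaps A. \<delta> \<le> d - c}"
proof (rule ccontr)
  let ?G = "{(c, d) \<in> gaps A. \<delta> \<le> d - c}"
  assume "infinite ?G"
  obtain n :: nat where n: "b - a < real n * \<delta>"
    using assms(3) reals_Archimedean3 by blast
  obtain F where F: "finite F" "card F = n" "F \<subseteq> ?G"
    using infinite_arbitrarily_large[OF \<open>infinite ?G\<close>] by blast
  have "real n * \<delta> = (\<Sum>g\<in>F. \<delta>)"
    using F(2) by simp
  also have "\<dots> \<le> (\<Sum>(c, d)\<in>F. d - c)"
    using F(3) by (intro sum_mono) auto
  also have "\<dots> \<le> b - a"
    using F assms by (intro sum_gap_lengths_le) auto
  finally show False
    using n by simp
qed

section \<open>The volume function and its kinks\<close>

lemma parallel_set_eq: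
  assumes A: "compact A" "a \<in> A" "b \<in> A" "A \<subseteq> {a..b}" and r: "r > 0"
  shows "parallel_set A r
    = {a - r<..<b + r} - (\<Union>(c, d)\<in>{(c, d) \<in> gaps A. 2 * r \<le> d - c}. {c + r..d - r})"
    (is "_ = ?I - ?U")
proof (intro set_eqI iffI)
  fix x assume x: "x \<in> parallel_set A r"
  obtain y where y: "y \<in> A" "infdist x A = dist x y"
    using infdist_attains_inf[of A x] A compact_imp_closed by blast
  then have xy: "\<bar>x - y\<bar> < r"
    using x unfolding parallel_set_def by (simp add: dist_real_def)
  have "x \<in> ?I"
    using xy y(1) A(4) by (auto simp: abs_less_iff)
  moreover have "x \<notin> ?U"
    using xy gapsD(4)[OF _ y(1)] by fastforce
  ultimately show "x \<in> ?I - ?U" by blast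
next
  fix x assume x: "x \<in> ?I - ?U"
  have near: "x \<in> parallel_set A r" if "y \<in> A" "\<bar>x - y\<bar> < r" for y
    using infdist_le[OF that(1), of x] that(2) by (simp add: parallel_set_def dist_real_def)
  show "x \<in> parallel_set A r"
  proof (cases "x \<in> A \<or> x \<le> a \<or> b \<le> x")
    case True
    then show ?thesis
      using x near A(2,3) r by (auto simp: abs_less_iff)
  next
    case False
    then obtain c d where cd: "(c, d) \<in> gaps A" "c < x" "x < d"
      using exists_gap A by (metis linorder_not_le)
    then have "x < c + r \<or> d - r < x"
      using x by force
    then show ?thesis
      using near gapsD(2,3)[OF cd(1)] cd(2,3) by (auto simp: abs_less_iff)
  qed
qed

lemma parallel_volume_eq:
  assumes A: "compact A" "a \<in> A" "b \<in> A" "A \<subseteq> {a..b}" and r: "r > 0"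
    and F: "finite F" "F \<subseteq> gaps A" "{(c, d) \<in> gaps A. 2 * r \<le> d - c} \<subseteq> F"
  shows "parallel_volume A r = b - a + 2 * r - (\<Sum>(c, d)\<in>F. max (d - c - 2 * r) 0)"
proof -
  let ?G = "{(c, d) \<in> gaps A. 2 * r \<le> d - c}"
  let ?J = "\<lambda>(c, d). {c + r..d - r}"
  have fin: "finite ?G"
    using F finite_subset by blast
  have ab: "a \<le> b"
    using A by auto
  have "measure lebesgue (\<Union>g\<in>?G. ?J g) = (\<Sum>g\<in>?G. measure lebesgue (?J g))"
  proof (rule measure_UNION')
    show "pairwise (\<lambda>g h. disjnt (?J g) (?J h)) ?G"
    proof -
      have "g = h" if "g \<in> ?G" "h \<in> ?G" "x \<in> ?J g" "x \<in> ?J h" for g h x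
        using that gaps_overlap_eq[of "fst g" "snd g" A "fst h" "snd h" x] r by auto
      then show ?thesis
        unfolding pairwise_def disjnt_iff by blast
    qed
  qed (use fin in auto)
  also have "\<dots> = (\<Sum>(c, d)\<in>?G. max (d - c - 2 * r) 0)"
    by (intro sum.cong) (auto simp: max_def)
  also have "\<dots> = (\<Sum>(c, d)\<in>F. max (d - c - 2 * r) 0)"
    using F by (intro sum.mono_neutral_left) (auto simp: max_def split: if_splits)
  finally have m: "measure lebesgue (\<Union>g\<in>?G. ?J g) = (\<Sum>(c, d)\<in>F. max (d - c - 2 * r) 0)" .
  have "parallel_volume A r = measure lebesgue ({a - r<..<b + r} - (\<Union>g\<in>?G. ?J g))"
    unfolding parallel_volume_def parallel_set_eq[OF A r] by (simp add: case_prod_beta)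
  also have "\<dots> = measure lebesgue {a - r<..<b + r} - measure lebesgue (\<Union>g\<in>?G. ?J g)"
  proof (rule measurable_measure_Diff)
    show "(\<Union>g\<in>?G. ?J g) \<in> sets lebesgue"
      using fin by (intro sets.finite_UN) auto
    show "(\<Union>g\<in>?G. ?J g) \<subseteq> {a - r<..<b + r}"
    proof clarsimp
      fix c d x assume "(c, d) \<in> gaps A" "c + r \<le> x" "x \<le> d - r"
      then show "a - r < x \<and> x < b + r"
        using gapsD(2,3)[of c d A] A(4) r by fastforce
    qed
  qed auto
  finally show ?thesis
    using m r ab by simp
qed

lemma differentiable_max_affine:
  fixes l s :: real
  assumes "l \<noteq> 2 * s"
  shows "(\<lambda>r. max (l - 2 * r) 0) differentiable at s"
proof (cases "l < 2 * s")
  case True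
  have "\<forall>\<^sub>F r in nhds s. r \<in> {l / 2<..}"
    using True by (intro eventually_nhds_in_open) auto
  then have "((\<lambda>r. max (l - 2 * r) 0) has_real_derivative 0) (at s)
      \<longleftrightarrow> ((\<lambda>r. 0) has_real_derivative 0) (at s)"
    by (intro DERIV_cong_ev) (auto elim!: eventually_mono)
  then show ?thesis
    using real_differentiable_def by fastforce
next
  case False
  have "\<forall>\<^sub>F r in nhds s. r \<in> {..<l / 2}"
    using False assms by (intro eventually_nhds_in_open) auto
  then have "((\<lambda>r. max (l - 2 * r) 0) has_real_derivative - 2) (at s)
      \<longleftrightarrow> ((\<lambda>r. l - 2 * r) has_real_derivative - 2) (at s)"
    by (intro DERIV_cong_ev) (auto elim!: eventually_mono)
  moreover have "((\<lambda>r. l - 2 * r) has_real_derivative - 2) (at s)"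
    by (auto intro!: derivative_eq_intros)
  ultimately show ?thesis
    using real_differentiable_def by blast
qed

lemma not_differentiable_max_affine:
  fixes s :: real
  shows "\<not> (\<lambda>r. max (2 * s - 2 * r) 0) differentiable at s"
proof
  assume "(\<lambda>r. max (2 * s - 2 * r) 0) differentiable at s"
  then obtain D where D: "((\<lambda>r. max (2 * s - 2 * r) 0) has_real_derivative D) (at s)"
    using real_differentiable_def by blast
  \<comment> \<open>The function has a minimum at \<open>s\<close>, and still has one when \<open>2 * s - 2 * r\<close> is subtracted.\<close>
  have "D = 0"
    by (rule DERIV_local_min[OF D, of 1]) auto
  moreover have "((\<lambda>r. max (2 * s - 2 * r) 0 - (2 * s - 2 * r)) has_real_derivative D + 2) (at s)"
    by (auto intro!: derivative_eq_intros D)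
  then have "D + 2 = 0"
    by (rule DERIV_local_min[of _ _ _ 1]) auto
  ultimately show False by simp
qed

lemma differentiable_parallel_volume_iff:
  assumes A: "compact A" "a \<in> A" "b \<in> A" "A \<subseteq> {a..b}" and s: "s > 0"
  shows "parallel_volume A differentiable at s \<longleftrightarrow> (\<forall>(c, d)\<in>gaps A. d - c \<noteq> 2 * s)"
proof -
  \<comment> \<open>For \<open>r > s / 2\<close> only the finitely many gaps in \<open>F\<close> contribute to the volume; those
    in \<open>E\<close> have their kink at \<open>s\<close>, and \<open>g\<close> is the volume formula without their terms.\<close>
  define F where "F = {(c, d) \<in> gaps A. s \<le> d - c}"
  define E where "E = {(c, d) \<in> F. d - c = 2 * s}"
  define g where "g = (\<lambda>r. b - a + 2 * r - (\<Sum>(c, d)\<in>F - E. max (d - c - 2 * r) 0))"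
  have "a \<le> b"
    using A by auto
  then have fin: "finite F" "E \<subseteq> F"
    using finite_long_gaps[of A a b s] A s unfolding F_def E_def by auto
  then have finE: "finite E"
    using finite_subset by blast
  have vol: "parallel_volume A r = g r - card E * max (2 * s - 2 * r) 0" if "r > s / 2" for r
  proof -
    have "parallel_volume A r = b - a + 2 * r - (\<Sum>(c, d)\<in>F. max (d - c - 2 * r) 0)"
      using that s fin by (intro parallel_volume_eq[OF A]) (auto simp: F_def)
    also have "(\<Sum>(c, d)\<in>F. max (d - c - 2 * r) 0)
        = (\<Sum>(c, d)\<in>F - E. max (d - c - 2 * r) 0) + (\<Sum>(c, d)\<in>E. max (d - c - 2 * r) 0)"
      using fin by (intro sum.subset_diff)
    also have "(\<Sum>(c, d)\<in>E. max (d - c - 2 * r) 0) = (\<Sum>e\<in>E. max (2 * s - 2 * r) 0)"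
      by (intro sum.cong) (auto simp: E_def)
    finally show ?thesis
      by (simp add: g_def)
  qed
  have near: "\<forall>\<^sub>F r in nhds s. r \<in> {s / 2<..}"
    using s by (intro eventually_nhds_in_open) auto
  have "(\<lambda>r. max (snd e - fst e - 2 * r) 0) differentiable at s" if "e \<in> F - E" for e
    using that by (intro differentiable_max_affine) (auto simp: E_def)
  then have g: "g differentiable at s"
    unfolding g_def case_prod_beta
    by (intro differentiable_diff differentiable_sum differentiable_add differentiable_mult)
      (use fin in auto)
  have E_empty: "E = {} \<longleftrightarrow> (\<forall>(c, d)\<in>gaps A. d - c \<noteq> 2 * s)"
    using s by (fastforce simp: E_def F_def)
  have diff_iff: "parallel_volume A differentiable at s
      \<longleftrightarrow> (\<lambda>r. g r - card E * max (2 * s - 2 * r) 0) differentiable at s"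
    unfolding real_differentiable_def
    by (intro ex_cong1 DERIV_cong_ev refl eventually_mono[OF near]) (auto simp: vol)
  show ?thesis
  proof (cases "E = {}")
    case True
    then show ?thesis
      using diff_iff g E_empty by simp
  next
    case False
    \<comment> \<open>All gaps in \<open>E\<close> contribute the same function, so the kink is multiplied by \<open>card E > 0\<close>.\<close>
    have "\<not> (\<lambda>r. g r - card E * max (2 * s - 2 * r) 0) differentiable at s"
    proof
      assume h: "(\<lambda>r. g r - card E * max (2 * s - 2 * r) 0) differentiable at s"
      have "(\<lambda>r. (g r - (g r - card E * max (2 * s - 2 * r) 0)) / card E) differentiable at s"
        using False finE by (intro differentiable_divide differentiable_diff[OF g h]) auto
      moreover have "(\<lambda>r. (g r - (g r - card E * max (2 * s - 2 * r) 0)) / card E)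
          = (\<lambda>r. max (2 * s - 2 * r) 0)"
        using False finE by auto
      ultimately show False
        using not_differentiable_max_affine by metis
    qed
    then show ?thesis
      unfolding diff_iff E_empty[symmetric] using False by simp
  qed
qed

lemma nondiff_radii_eq_half_gap_lengths:
  fixes A :: "real set"
  assumes "compact A" "A \<noteq> {}"
  shows "nondiff_radii A = (\<lambda>(c, d). (d - c) / 2) ` gaps A"
proof -
  obtain a b where ab: "a \<in> A" "b \<in> A" "A \<subseteq> {a..b}"
    using compact_attains_inf[OF assms] compact_attains_sup[OF assms]
    by (metis atLeastAtMost_iff subsetI)
  have "s \<in> nondiff_radii A \<longleftrightarrow> (\<exists>(c, d)\<in>gaps A. s = (d - c) / 2)" for s
  proof (cases "s > 0")
    case True
    then show ?thesis
      using differentiable_parallel_volume_iff[OF assms(1) ab True]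
      by (force simp: nondiff_radii_def)
  next
    case False
    then show ?thesis
      by (auto simp: nondiff_radii_def dest: gapsD)
  qed
  then show ?thesis
    unfolding image_def case_prod_beta by blast
qed

section \<open>Sums of half-lengths\<close>

lemma infsum_nondiff_radii_finite:
  fixes A :: "real set"
  assumes "compact A" "A \<noteq> {}"
  shows "(\<Sum>\<^sub>\<infinity>s\<in>nondiff_radii A. ennreal s) < \<infinity>"
proof -
  obtain a b where ab: "a \<in> A" "b \<in> A" "A \<subseteq> {a..b}"
    using compact_attains_inf[OF assms] compact_attains_sup[OF assms]
    by (metis atLeastAtMost_iff subsetI)
  let ?h = "\<lambda>(c, d). (d - c) / 2 :: real"
  have "(\<Sum>s\<in>S. ennreal s) \<le> ennreal ((b - a) / 2)"
    if S: "finite S" "S \<subseteq> nondiff_radii A" for S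
  proof -
    have "S \<subseteq> ?h ` gaps A"
      using S(2) nondiff_radii_eq_half_gap_lengths[OF assms] by simp
    then obtain F where F: "F \<subseteq> gaps A" "inj_on ?h F" "S = ?h ` F"
      by (auto simp: subset_image_inj)
    have "finite F"
      using F S(1) finite_imageD by blast
    then have "(\<Sum>(c, d)\<in>F. d - c) \<le> b - a"
      using F ab by (intro sum_gap_lengths_le) auto
    moreover have "sum id S = (\<Sum>(c, d)\<in>F. d - c) / 2"
      unfolding F(3) sum.reindex[OF F(2)] sum_divide_distrib by (intro sum.cong) auto
    moreover have "(\<Sum>s\<in>S. ennreal s) = ennreal (sum id S)"
      using S(2) by (subst sum_ennreal[symmetric]) (auto simp: nondiff_radii_def)
    ultimately show ?thesis
      by (simp add: ennreal_leI)
  qed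
  then have "(\<Sum>\<^sub>\<infinity>s\<in>nondiff_radii A. ennreal s) \<le> ennreal ((b - a) / 2)"
    unfolding infsum_ennreal_eq_SUP by (intro SUP_least) auto
  then show ?thesis
    using le_less_trans[OF _ ennreal_less_top] by simp
qed

lemma summable_on_of_infsum_ennreal_finite:
  fixes N :: "real set"
  assumes "N \<subseteq> {0<..}" "(\<Sum>\<^sub>\<infinity>s\<in>N. ennreal s) < \<infinity>"
  shows "(\<lambda>s. s) summable_on N"
proof (rule nonneg_bdd_above_summable_on)
  obtain u where u: "u \<ge> 0" "(\<Sum>\<^sub>\<infinity>s\<in>N. ennreal s) = ennreal u"
    using assms(2) by (metis ennreal_cases infinity_ennreal_def less_irrefl)
  have "sum (\<lambda>s. s) S \<le> u" if "finite S" "S \<subseteq> N" for S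
  proof -
    have "ennreal (sum (\<lambda>s. s) S) = (\<Sum>s\<in>S. ennreal s)"
      using that assms(1) by (subst sum_ennreal) force+
    also have "\<dots> \<le> ennreal u"
      unfolding u(2)[symmetric] infsum_ennreal_eq_SUP using that by (intro SUP_upper) auto
    finally show ?thesis
      using u(1) by simp
  qed
  then show "bdd_above (sum (\<lambda>s. s) ` {F. F \<subseteq> N \<and> finite F})"
    by (auto intro!: bdd_aboveI)
qed (use assms(1) in force)

text \<open>The set is a compact interval minus pairwise disjoint open intervals of the prescribed
  lengths. Two of these may share an endpoint, but that endpoint stays in the set, so they do not
  merge into one gap.\<close>

lemma exists_compact_with_gap_lengths:
  fixes N :: "real set"
  assumes N: "N \<subseteq> {0<..}" and summ: "(\<lambda>s. s) summable_on N"
  obtains A :: "real set" where "compact A" "A \<noteq> {}" "(\<lambda>(c, d). (d - c) / 2) ` gaps A = N"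
proof -
  \<comment> \<open>The interval for \<open>s\<close> is put to the right of the intervals for all smaller elements of \<open>N\<close>.\<close>
  define left where "left s = 2 * (\<Sum>\<^sub>\<infinity>t\<in>{t \<in> N. t < s}. t)" for s
  define L where "L = 2 * (\<Sum>\<^sub>\<infinity>t\<in>N. t)"
  define I where "I s = {left s<..<left s + 2 * s}" for s
  define A where "A = {0..L} - (\<Union>s\<in>N. I s)"
  have summ': "(\<lambda>s. s) summable_on M" if "M \<subseteq> N" for M
    using summable_on_subset_banach[OF summ that] .
  have left_le: "left s + 2 * s \<le> 2 * (\<Sum>\<^sub>\<infinity>t\<in>M. t)"
    if "s \<in> N" "{t \<in> N. t < s} \<subseteq> M" "s \<in> M" "M \<subseteq> N" for s M
  proof -
    have "(\<Sum>\<^sub>\<infinity>t\<in>insert s {t \<in> N. t < s}. t) \<le> (\<Sum>\<^sub>\<infinity>t\<in>M. t)"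
      using that N by (intro infsum_mono_neutral summ') auto
    moreover have "(\<Sum>\<^sub>\<infinity>t\<in>insert s {t \<in> N. t < s}. t) = s + (\<Sum>\<^sub>\<infinity>t\<in>{t \<in> N. t < s}. t)"
      by (intro infsum_insert summ') auto
    ultimately show ?thesis
      by (simp add: left_def)
  qed
  have left_mono: "left s + 2 * s \<le> left t" if "s \<in> N" "t \<in> N" "s < t" for s t
    using left_le[of s "{u \<in> N. u < t}"] that by (force simp: left_def)
  have left_le_L: "left s + 2 * s \<le> L" if "s \<in> N" for s
    using left_le[of s N] that by (force simp: L_def)
  have nonneg: "0 \<le> left s" "0 \<le> L" for s
    using N by (auto simp: left_def L_def intro!: infsum_nonneg)
  have endpoints: "left s \<in> A" "left s + 2 * s \<in> A" if s: "s \<in> N" for s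
  proof -
    have "left s \<notin> I t \<and> left s + 2 * s \<notin> I t" if "t \<in> N" for t
      using left_mono[of s t] left_mono[of t s] s that N
      by (cases s t rule: linorder_cases) (force simp: I_def)+
    then show "left s \<in> A" "left s + 2 * s \<in> A"
      using left_le_L[OF s] nonneg(1)[of s] s N by (force simp: A_def)+
  qed
  have gap: "(left s, left s + 2 * s) \<in> gaps A" if "s \<in> N" for s
    using endpoints[OF that] that N by (auto simp: gaps_def A_def I_def)
  have gaps_eq: "gaps A = (\<lambda>s. (left s, left s + 2 * s)) ` N"
  proof (intro equalityI subsetI)
    fix p assume p: "p \<in> gaps A"
    obtain c d where cd: "p = (c, d)" by fastforce
    define m where "m = (c + d) / 2"
    have m: "c < m" "m < d" "c \<in> A" "d \<in> A"
      using gapsD[of c d A] p cd by (auto simp: m_def)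
    then have "m \<notin> A"
      using gapsD(4)[of c d A m] p cd by auto
    then obtain s where s: "s \<in> N" "m \<in> I s"
      using m by (auto simp: A_def)
    have "(c, d) = (left s, left s + 2 * s)"
      using p cd m s by (intro gaps_overlap_eq[OF _ gap[OF s(1)]]) (auto simp: I_def)
    then show "p \<in> (\<lambda>s. (left s, left s + 2 * s)) ` N"
      using s(1) cd by blast
  qed (use gap in auto)
  show thesis
  proof
    show "compact A"
      unfolding A_def I_def by (intro compact_diff open_UN) auto
    have "0 \<in> A"
      using nonneg by (auto simp: A_def I_def not_less)
    then show "A \<noteq> {}" by blast
    show "(\<lambda>(c, d). (d - c) / 2) ` gaps A = N"
      by (simp add: gaps_eq image_image)
  qed
qed

theorem theorem1p2:
  fixes N :: "real set"
  assumes "N \<subseteq> {0<..}"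
  shows "(\<exists>A :: real set. compact A \<and> A \<noteq> {} \<and> nondiff_radii A = N)
    \<longleftrightarrow> (\<Sum>\<^sub>\<infinity>s\<in>N. ennreal s) < \<infinity>"
proof
  assume "\<exists>A :: real set. compact A \<and> A \<noteq> {} \<and> nondiff_radii A = N"
  then show "(\<Sum>\<^sub>\<infinity>s\<in>N. ennreal s) < \<infinity>"
    using infsum_nondiff_radii_finite by blast
next
  assume "(\<Sum>\<^sub>\<infinity>s\<in>N. ennreal s) < \<infinity>"
  then obtain A :: "real set"
    where "compact A" "A \<noteq> {}" "(\<lambda>(c, d). (d - c) / 2) ` gaps A = N"
    using exists_compact_with_gap_lengths summable_on_of_infsum_ennreal_finite assms by metis
  then show "\<exists>A :: real set. compact A \<and> A \<noteq> {} \<and> nondiff_radii A = N"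
    using nondiff_radii_eq_half_gap_lengths by metis
qed

end
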